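(* $\mathcal A(\ell_2^2\oplus_1\ell_2^2,\,c)=(0,1)$.
   Context: $\ell_2^2\oplus_1\ell_2^2$ denotes $\mathbb R^4$ equipped with the norm $\|(s,t,u,v)\|=(s^2+t^2)^{1/2}+(u^2+v^2)^{1/2}$. $c$ denotes the space of all real converging sequences, equipped with the supremum norm. For metric spaces $(X,d)$, $(Y,\varrho)$, $\alpha\in(0,1]$ and $K>0$, a map $f:X\to Y$ is called $(K,\alpha)$-Hölder if $\varrho(f(x),f(y))\le K d(x,y)^\alpha$ for all $x,y\in X$. $\mathcal A(X,Y)$ denotes the set of all $\alpha\in(0,1]$ such that for every $K>0$ and every subset $M\subset X$, any $(K,\alpha)$-Hölder function $f:M\to Y$ can be extended to a $(K,\alpha)$-Hölder function from $X$ into $Y$ (same constant $K$). Normed spaces are viewed as metric spaces with the norm distance. *)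

theory Defs
  imports "HOL-Analysis.Analysis"
begin

definition l2_sum1_norm :: "real ^ 4 \<Rightarrow> real" where
  "l2_sum1_norm x = sqrt ((x $ 1)\<^sup>2 + (x $ 2)\<^sup>2) + sqrt ((x $ 3)\<^sup>2 + (x $ 4)\<^sup>2)"

definition l2_sum1_metric :: "(real ^ 4) metric" where
  "l2_sum1_metric = metric (UNIV, \<lambda>x y. l2_sum1_norm (x - y))"

text \<open>
  The topology of \<^typ>\<open>nat\<close> is discrete, so \<^typ>\<open>nat \<Rightarrow>\<^sub>C real\<close> consists of all bounded sequences,
  with the supremum norm.
\<close>

definition c_metric :: "(nat \<Rightarrow>\<^sub>C real) metric" where
  "c_metric = submetric euclidean_metric {x. convergent (apply_bcontfun x)}"

definition holder_map :: "'a metric \<Rightarrow> 'b metric \<Rightarrow> real \<Rightarrow> real \<Rightarrow> ('a \<Rightarrow> 'b) \<Rightarrow> bool" where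
  "holder_map X Y K \<alpha> f \<longleftrightarrow>
     f \<in> mspace X \<rightarrow> mspace Y \<and>
     (\<forall>x\<in>mspace X. \<forall>y\<in>mspace X. mdist Y (f x) (f y) \<le> K * mdist X x y powr \<alpha>)"

definition holder_ext_exponents :: "'a metric \<Rightarrow> 'b metric \<Rightarrow> real set" where
  "holder_ext_exponents X Y =
     {\<alpha>. 0 < \<alpha> \<and> \<alpha> \<le> 1 \<and>
        (\<forall>K>0. \<forall>M \<subseteq> mspace X. \<forall>f. holder_map (submetric X M) Y K \<alpha> f \<longrightarrow>
           (\<exists>g. holder_map X Y K \<alpha> g \<and> (\<forall>x\<in>M. g x = f x)))}"

text \<open>
  \<^const>\<open>metric\<close> yields the intended space only if its argument satisfies the metric axioms.
\<close>

lemma l2_sum1_norm_triangle: "l2_sum1_norm (x + y) \<le> l2_sum1_norm x + l2_sum1_norm y"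
  unfolding l2_sum1_norm_def
  using real_sqrt_sum_squares_triangle_ineq[of "x $ 1" "y $ 1" "x $ 2" "y $ 2"]
    real_sqrt_sum_squares_triangle_ineq[of "x $ 3" "y $ 3" "x $ 4" "y $ 4"]
  by simp

lemma l2_sum1_norm_eq_0: "l2_sum1_norm x = 0 \<longleftrightarrow> x = 0"
proof -
  have "l2_sum1_norm x = 0 \<longleftrightarrow>
      sqrt ((x $ 1)\<^sup>2 + (x $ 2)\<^sup>2) = 0 \<and> sqrt ((x $ 3)\<^sup>2 + (x $ 4)\<^sup>2) = 0"
    unfolding l2_sum1_norm_def by (intro add_nonneg_eq_0_iff) auto
  also have "\<dots> \<longleftrightarrow> x = 0"
    by (auto simp: vec_eq_iff forall_4 sum_power2_eq_zero_iff)
  finally show ?thesis .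
qed

lemma l2_sum1_norm_minus_commute: "l2_sum1_norm (x - y) = l2_sum1_norm (y - x)"
  by (simp add: l2_sum1_norm_def power2_commute)

lemma Metric_space_l2_sum1: "Metric_space UNIV (\<lambda>x y. l2_sum1_norm (x - y))"
proof
  show "0 \<le> l2_sum1_norm (x - y)" for x y
    by (simp add: l2_sum1_norm_def)
  show "l2_sum1_norm (x - z) \<le> l2_sum1_norm (x - y) + l2_sum1_norm (y - z)" for x y z
    using l2_sum1_norm_triangle[of "x - y" "y - z"] by simp
qed (simp_all add: l2_sum1_norm_minus_commute l2_sum1_norm_eq_0)

lemma mspace_l2_sum1: "mspace l2_sum1_metric = UNIV"
  and mdist_l2_sum1: "mdist l2_sum1_metric x y = l2_sum1_norm (x - y)"
  using Metric_space.mspace_metric[OF Metric_space_l2_sum1]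
    Metric_space.mdist_metric[OF Metric_space_l2_sum1]
  by (simp_all add: l2_sum1_metric_def)

lemma apply_bcontfun_mspace_c: "apply_bcontfun ` mspace c_metric = {x. convergent x}"
proof (intro equalityI subsetI)
  fix x :: "nat \<Rightarrow> real"
  assume x: "x \<in> {x. convergent x}"
  then have "bounded (range x)"
    by (simp add: convergent_imp_Bseq Bseq_eq_bounded[symmetric])
  then have "x \<in> bcontfun"
    by (simp add: bcontfun_def)
  then have "apply_bcontfun (Bcontfun x) = x" by (rule Bcontfun_inverse)
  with x show "x \<in> apply_bcontfun ` mspace c_metric"
    by (intro image_eqI[of _ _ "Bcontfun x"]) (simp_all add: c_metric_def)
qed (auto simp: c_metric_def)

lemma mdist_c: "mdist c_metric x y = (SUP n. \<bar>apply_bcontfun x n - apply_bcontfun y n\<bar>)"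
  by (simp add: c_metric_def dist_bcontfun_def dist_real_def)

end

theory Submission
  imports Defs "HOL-Real_Asymp.Real_Asymp"
begin

text \<open>
  For \<open>\<alpha> < 1\<close>, Zorn's lemma reduces the extension to a single new point \<open>x\<close>. The admissible values
  of the \<open>n\<close>-th coordinate at \<open>x\<close> form an interval \<open>[a n, b n]\<close>, and a convergent choice exists as
  soon as \<open>limsup a \<le> liminf b\<close>. On bounded sets this follows from pointwise convergence and
  equicontinuity, since bounded sets are totally bounded; points far from \<open>x\<close> are harmless because
  \<open>d(x,s)\<^sup>\<alpha> - d(s0,s)\<^sup>\<alpha>\<close> tends to \<open>0\<close> as \<open>s\<close> tends to infinity.

  For \<open>\<alpha> = 1\<close> that difference tends to a Busemann function instead. Let \<open>u n\<close> and \<open>v n\<close> run to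
  infinity along a parabola in the second and in the first Euclidean plane. The functions
  \<open>1 + \<parallel>u n\<parallel> - \<parallel>u n - z\<parallel>\<close> (\<open>n\<close> even) and \<open>- 1 - \<parallel>v n\<parallel> + \<parallel>v n - z\<parallel>\<close> (\<open>n\<close> odd) have the
  same limit when \<open>z\<close> is on one of the parabolas, but every 1-Lipschitz extension to the origin is
  at least \<open>1\<close> for even and at most \<open>- 1\<close> for odd \<open>n\<close>.
\<close>

section \<open>Extension for exponents below one\<close>

text \<open>Scaling to \<open>a + b = 1\<close> reduces this to
  \<open>t \<le> t powr \<alpha>\<close> on the unit interval. It provides a triangle inequality for
  \<open>d powr \<alpha>\<close>.\<close>

lemma powr_add_le_add_powr:
  fixes a b \<alpha> :: real
  assumes "0 < \<alpha>" "\<alpha> \<le> 1" "0 \<le> a" "0 \<le> b"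
  shows "(a + b) powr \<alpha> \<le> a powr \<alpha> + b powr \<alpha>"
proof (cases "a + b = 0")
  case False
  with assms have ab: "0 < a + b" by linarith
  have le: "t \<le> t powr \<alpha>" if "0 \<le> t" "t \<le> 1" for t :: real
    using powr_mono'[of \<alpha> 1 t] that assms by simp
  have "1 = a / (a + b) + b / (a + b)"
    using ab by (simp flip: add_divide_distrib)
  also have "\<dots> \<le> (a / (a + b)) powr \<alpha> + (b / (a + b)) powr \<alpha>"
    using ab assms by (intro add_mono le) auto
  also have "\<dots> = (a powr \<alpha> + b powr \<alpha>) / (a + b) powr \<alpha>"
    using ab assms by (simp add: powr_divide add_divide_distrib)
  finally show ?thesis
    using ab by (simp add: pos_le_divide_eq)
qed (use assms in auto)

section \<open>Adding one point: convergent sequences of Hoelder functions\<close>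

context Metric_space
begin

text \<open>This is the bound on the limsup of the lower interval ends \<open>a n\<close>; applied
  to \<open>- f\<close> it bounds the liminf of the upper ends. A finite net handles the points near
  \<open>x\<close>, and the single point \<open>s0\<close> supplied by \<open>near\<close> handles
  all far ones.\<close>

lemma holder_upper_envelope_eventually_le:
  fixes f :: "nat \<Rightarrow> 'a \<Rightarrow> real"
  assumes \<alpha>: "0 < \<alpha>" "\<alpha> < 1" and K: "K > 0"
    and tot: "\<And>B. mbounded B \<Longrightarrow> mtotally_bounded B"
    and S: "S \<subseteq> M" and x: "x \<in> M"
    and hold: "\<And>n s t. s \<in> S \<Longrightarrow> t \<in> S \<Longrightarrow> \<bar>f n s - f n t\<bar> \<le> K * d s t powr \<alpha>"
    and lim: "\<And>s. s \<in> S \<Longrightarrow> (\<lambda>n. f n s) \<longlonglongrightarrow> F s"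
    and L: "\<And>s. s \<in> S \<Longrightarrow> F s - K * d x s powr \<alpha> \<le> L"
    and near: "\<And>e. e > 0 \<Longrightarrow> \<exists>s\<in>S. F s < L + e"
    and e: "e > 0"
  shows "\<forall>\<^sub>F n in sequentially. \<forall>s\<in>S. f n s - K * d x s powr \<alpha> \<le> L + e"
proof -
  obtain s0 where s0: "s0 \<in> S" "F s0 < L + e / 2"
    using near[of "e / 2"] e by auto
  then have s0M: "s0 \<in> M" using S by auto
  have ev0: "\<forall>\<^sub>F n in sequentially. f n s0 < L + e / 2"
    using order_tendstoD(2)[OF lim[OF s0(1)] s0(2)] .
  \<comment> \<open>Here \<open>\<alpha> < 1\<close> enters: far from \<open>x\<close>, moving the centre from \<open>x\<close> to \<open>s0\<close> changes
    \<open>d x s powr \<alpha>\<close> by an arbitrarily small amount.\<close>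
  have "((\<lambda>r. (r + d x s0) powr \<alpha> - r powr \<alpha>) \<longlongrightarrow> 0) at_top"
    using \<alpha> nonneg[of x s0] by real_asymp
  then have "\<forall>\<^sub>F r in at_top. (r + d x s0) powr \<alpha> - r powr \<alpha> < e / (2 * K)"
    using e K by (intro order_tendstoD(2)) auto
  then obtain R where R: "\<And>r. r \<ge> R \<Longrightarrow> (r + d x s0) powr \<alpha> - r powr \<alpha> < e / (2 * K)"
    by (auto simp: eventually_at_top_linorder)
  \<comment> \<open>Three errors of \<open>e / 3\<close> occur: moving from \<open>s\<close> to a
    net point \<open>t\<close> costs one in \<open>f n\<close> and one in
    \<open>d x s powr \<alpha>\<close>, and \<open>f n t\<close> against \<open>F t\<close> costs
    the third.\<close>
  define \<delta> where "\<delta> = (e / (3 * K)) powr (1 / \<alpha>)"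
  have \<delta>: "\<delta> > 0" "K * \<delta> powr \<alpha> = e / 3"
    using e K \<alpha> by (auto simp: \<delta>_def powr_powr)
  have small: "K * r powr \<alpha> \<le> e / 3" if "0 \<le> r" "r < \<delta>" for r
  proof -
    have "r powr \<alpha> \<le> \<delta> powr \<alpha>"
      using that \<alpha> by (intro powr_mono2) auto
    then show ?thesis
      using \<delta>(2) K mult_left_mono[of "r powr \<alpha>" "\<delta> powr \<alpha>" K] by linarith
  qed
  have "mtotally_bounded (S \<inter> mcball x R)"
    by (intro tot) (auto simp: mbounded_def)
  then obtain T where T: "finite T" "T \<subseteq> S" and net: "S \<inter> mcball x R \<subseteq> (\<Union>t\<in>T. mball t \<delta>)"
    unfolding mtotally_bounded_def using \<delta>(1) by (metis Int_subset_iff)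
  have "\<forall>\<^sub>F n in sequentially. \<forall>t\<in>T. f n t < F t + e / 3"
  proof (intro eventually_ball_finite ballI T(1))
    fix t assume "t \<in> T"
    then show "\<forall>\<^sub>F n in sequentially. f n t < F t + e / 3"
      using T(2) e by (intro order_tendstoD(2)[OF lim]) auto
  qed
  with ev0 show ?thesis
  proof eventually_elim
    case (elim n)
    show ?case
    proof
      fix s assume s: "s \<in> S"
      then have sM: "s \<in> M" using S by auto
      show "f n s - K * d x s powr \<alpha> \<le> L + e"
      proof (cases "d x s \<le> R")
        case True
        with s sM x have "s \<in> S \<inter> mcball x R" by simp
        with net have "s \<in> (\<Union>t\<in>T. mball t \<delta>)" by (rule subsetD)
        then obtain t where t: "t \<in> T" "d t s < \<delta>" by auto
        then have tS: "t \<in> S" and tM: "t \<in> M" using T S by auto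
        have "d x t powr \<alpha> \<le> (d x s + d t s) powr \<alpha>"
          using triangle[OF x sM tM] \<alpha> by (intro powr_mono2) (auto simp: commute)
        also have "\<dots> \<le> d x s powr \<alpha> + d t s powr \<alpha>"
          using \<alpha> by (intro powr_add_le_add_powr) auto
        finally have "K * d x t powr \<alpha> \<le> K * d x s powr \<alpha> + K * d t s powr \<alpha>"
          using K by (metis distrib_left mult_left_mono less_imp_le)
        moreover have "K * d t s powr \<alpha> \<le> e / 3"
          using t by (intro small) auto
        moreover have "\<bar>f n t - f n s\<bar> \<le> K * d t s powr \<alpha>"
          using hold[OF tS s] .
        moreover have "f n t < F t + e / 3"
          using elim(2) t(1) by blast
        ultimately show ?thesis
          using L[OF tS] by linarith
      next
        case False
        have "d s s0 powr \<alpha> \<le> (d x s + d x s0) powr \<alpha>"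
          using triangle[OF sM x s0M] \<alpha> by (intro powr_mono2) (auto simp: commute)
        with R[of "d x s"] False have "d s s0 powr \<alpha> \<le> d x s powr \<alpha> + e / (2 * K)"
          by linarith
        then have "K * d s s0 powr \<alpha> \<le> K * (d x s powr \<alpha> + e / (2 * K))"
          using K by (intro mult_left_mono) auto
        then have "K * d s s0 powr \<alpha> \<le> K * d x s powr \<alpha> + e / 2"
          using K by (simp add: distrib_left)
        with hold[OF s s0(1), of n] elim(1) show ?thesis
          by linarith
      qed
    qed
  qed
qed

text \<open>A value \<open>L\<close> admissible for the limit function \<open>F\<close> is fixed
  first; projecting \<open>L\<close> onto each interval of admissible values then gives a sequence
  tending to \<open>L\<close>.\<close>

lemma holder_convergent_one_point_extension:
  fixes f :: "nat \<Rightarrow> 'a \<Rightarrow> real"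
  assumes \<alpha>: "0 < \<alpha>" "\<alpha> < 1" and K: "K > 0"
    and tot: "\<And>B. mbounded B \<Longrightarrow> mtotally_bounded B"
    and S: "S \<subseteq> M" and x: "x \<in> M"
    and hold: "\<And>n s t. s \<in> S \<Longrightarrow> t \<in> S \<Longrightarrow> \<bar>f n s - f n t\<bar> \<le> K * d s t powr \<alpha>"
    and conv: "\<And>s. s \<in> S \<Longrightarrow> convergent (\<lambda>n. f n s)"
  shows "\<exists>y. convergent y \<and> (\<forall>n. \<forall>s\<in>S. \<bar>y n - f n s\<bar> \<le> K * d x s powr \<alpha>)"
proof (cases "S = {}")
  case True
  then show ?thesis by (auto intro: convergent_const)
next
  case S0: False
  define F where "F s = lim (\<lambda>n. f n s)" for s
  have lim: "(\<lambda>n. f n s) \<longlonglongrightarrow> F s" if "s \<in> S" for s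
    using conv[OF that] by (simp add: F_def convergent_LIMSEQ_iff)
  have holdF: "\<bar>F s - F t\<bar> \<le> K * d s t powr \<alpha>" if "s \<in> S" "t \<in> S" for s t
    by (rule tendsto_upperbound[OF tendsto_rabs[OF tendsto_diff[OF lim[OF that(1)] lim[OF that(2)]]]])
      (use hold that in auto)
  \<comment> \<open>The interval of admissible values at \<open>x\<close> is nonempty. A general
    \<open>h\<close> covers both \<open>F\<close> and every \<open>f n\<close>.\<close>
  have cone: "h s - K * d x s powr \<alpha> \<le> h t + K * d x t powr \<alpha>"
    if h: "\<And>s t. s \<in> S \<Longrightarrow> t \<in> S \<Longrightarrow> \<bar>h s - h t\<bar> \<le> K * d s t powr \<alpha>" and st: "s \<in> S" "t \<in> S"
    for h :: "'a \<Rightarrow> real" and s t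
  proof -
    have M: "s \<in> M" "t \<in> M" using st S by auto
    have "d s t powr \<alpha> \<le> (d x s + d x t) powr \<alpha>"
      using triangle[OF M(1) x M(2)] \<alpha> by (intro powr_mono2) (auto simp: commute)
    also have "\<dots> \<le> d x s powr \<alpha> + d x t powr \<alpha>"
      using \<alpha> by (intro powr_add_le_add_powr) auto
    finally have "K * d s t powr \<alpha> \<le> K * d x s powr \<alpha> + K * d x t powr \<alpha>"
      using K by (metis distrib_left mult_left_mono less_imp_le)
    with h[OF st] show ?thesis by linarith
  qed
  have Kd: "0 \<le> K * d x s powr \<alpha>" for s
    using K by simp
  \<comment> \<open>The conditions \<open>near\<close> and \<open>near'\<close> on \<open>L\<close> control far away points of an unbounded \<open>S\<close>.\<close>
  obtain L where L: "\<And>s. s \<in> S \<Longrightarrow> F s - K * d x s powr \<alpha> \<le> L"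
    and L': "\<And>s. s \<in> S \<Longrightarrow> L \<le> F s + K * d x s powr \<alpha>"
    and near: "\<And>e. e > 0 \<Longrightarrow> \<exists>s\<in>S. F s < L + e"
    and near': "\<And>e. e > 0 \<Longrightarrow> \<exists>s\<in>S. L - e < F s"
  proof -
    \<comment> \<open>\<open>A\<close> is the least value admissible for \<open>F\<close> at
      \<open>x\<close>. It satisfies \<open>near'\<close> because it is a supremum of values at most
      \<open>F s\<close>; only \<open>near\<close> can fail.\<close>
    define A where "A = (SUP s\<in>S. F s - K * d x s powr \<alpha>)"
    obtain s1 where s1: "s1 \<in> S" using S0 by auto
    have bdd: "bdd_above ((\<lambda>s. F s - K * d x s powr \<alpha>) ` S)"
      using cone[OF holdF _ s1] by (intro bdd_aboveI2)
    have A: "F s - K * d x s powr \<alpha> \<le> A" if "s \<in> S" for s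
      unfolding A_def by (rule cSUP_upper[OF that bdd])
    show thesis
    proof (cases "\<forall>e>0. \<exists>s\<in>S. F s < A + e")
      case True
      show thesis
      proof (rule that[of A])
        show "A \<le> F s + K * d x s powr \<alpha>" if "s \<in> S" for s
          unfolding A_def using cone[OF holdF _ that] S0 by (intro cSUP_least)
        show "\<exists>s\<in>S. A - e < F s" if "e > 0" for e
        proof -
          have "A - e < A" using that by simp
          then obtain s where "s \<in> S" "A - e < F s - K * d x s powr \<alpha>"
            unfolding A_def less_cSUP_iff[OF S0 bdd] by blast
          with Kd[of s] show ?thesis by (intro bexI[of _ s]) auto
        qed
      qed (use True A in auto)
    next
      case False
      \<comment> \<open>Now \<open>F\<close> stays above \<open>A\<close> by a fixed amount, so
        \<open>A\<close> can be raised to the infimum of \<open>F\<close>, which is still admissible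
        and is approached by values of \<open>F\<close>.\<close>
      then obtain e where e: "e > 0" "\<And>s. s \<in> S \<Longrightarrow> A + e \<le> F s"
        by (auto simp: not_less)
      then have bdd': "bdd_below (F ` S)" by (intro bdd_belowI2)
      have "A + e \<le> (INF s\<in>S. F s)"
        using e S0 by (intro cINF_greatest)
      then have "A \<le> (INF s\<in>S. F s)" using e(1) by linarith
      then have "F s - K * d x s powr \<alpha> \<le> (INF s\<in>S. F s)" if "s \<in> S" for s
        using A[OF that] by linarith
      moreover have low: "(INF s\<in>S. F s) \<le> F s" if "s \<in> S" for s
        by (rule cINF_lower[OF bdd' that])
      then have "(INF s\<in>S. F s) \<le> F s + K * d x s powr \<alpha>" if "s \<in> S" for s
        using that Kd[of s] by (meson add_increasing2)
      moreover have "\<exists>s\<in>S. F s < (INF s\<in>S. F s) + e" if "e > 0" for e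
        using cINF_less_iff[OF S0 bdd', of "(INF s\<in>S. F s) + e"] that by auto
      moreover have "\<exists>s\<in>S. (INF s\<in>S. F s) - e < F s" if "e > 0" for e
        using low[OF s1] that s1 by (intro bexI[of _ s1]) auto
      ultimately show thesis
        by (rule that[of "INF s\<in>S. F s"])
    qed
  qed
  define a where "a n = (SUP s\<in>S. f n s - K * d x s powr \<alpha>)" for n
  define b where "b n = (INF s\<in>S. f n s + K * d x s powr \<alpha>)" for n
  obtain s1 where s1: "s1 \<in> S" using S0 by auto
  have cone_n: "f n s - K * d x s powr \<alpha> \<le> f n t + K * d x t powr \<alpha>"
    if "s \<in> S" "t \<in> S" for n s t
    using cone[of "f n"] hold that by blast
  have a_ge: "f n s - K * d x s powr \<alpha> \<le> a n" if "s \<in> S" for n s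
    unfolding a_def using cone_n[OF _ s1] by (intro cSUP_upper that bdd_aboveI2)
  have b_le: "b n \<le> f n s + K * d x s powr \<alpha>" if "s \<in> S" for n s
    unfolding b_def using cone_n[OF s1] by (intro cINF_lower that bdd_belowI2)
  have ab: "a n \<le> b n" for n
    unfolding a_def b_def using S0 cone_n by (intro cSUP_least cINF_greatest)
  \<comment> \<open>\<open>L\<close> is clamped to \<open>[a n, b n]\<close>. Since
    \<open>a n \<le> L + e / 2\<close> and \<open>L - e / 2 \<le> b n\<close> eventually, clamping
    moves \<open>L\<close> by at most \<open>e / 2\<close>.\<close>
  define y where "y n = max (a n) (min (b n) L)" for n
  have "y \<longlonglongrightarrow> L"
  proof (rule tendstoI)
    fix e :: real assume "e > 0"
    then have e: "e / 2 > 0" by simp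
    have ev1: "\<forall>\<^sub>F n in sequentially. \<forall>s\<in>S. f n s - K * d x s powr \<alpha> \<le> L + e / 2"
      by (rule holder_upper_envelope_eventually_le[OF \<alpha> K tot S x hold lim L near e])
    have "\<forall>\<^sub>F n in sequentially. \<forall>s\<in>S. - f n s - K * d x s powr \<alpha> \<le> - L + e / 2"
    proof (rule holder_upper_envelope_eventually_le[OF \<alpha> K tot S x _ _ _ _ e])
      show "\<bar>- f n s - - f n t\<bar> \<le> K * d s t powr \<alpha>" if "s \<in> S" "t \<in> S" for n s t
        using hold[OF that, of n] by linarith
      show "(\<lambda>n. - f n s) \<longlonglongrightarrow> - F s" if "s \<in> S" for s
        using lim[OF that] by (rule tendsto_minus)
      show "- F s - K * d x s powr \<alpha> \<le> - L" if "s \<in> S" for s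
        using L'[OF that] by linarith
      show "\<exists>s\<in>S. - F s < - L + e" if "e > 0" for e
        using near'[OF that] by (auto simp: algebra_simps)
    qed
    with ev1 show "\<forall>\<^sub>F n in sequentially. dist (y n) L < e"
    proof eventually_elim
      case (elim n)
      have "a n \<le> L + e / 2"
        unfolding a_def using elim(1) S0 by (intro cSUP_least) auto
      moreover have "L - e / 2 \<le> b n"
        unfolding b_def using elim(2) S0 by (intro cINF_greatest) (auto simp: algebra_simps)
      ultimately show ?case
        using ab[of n] \<open>e > 0\<close> by (auto simp: y_def dist_real_def max_def min_def)
    qed
  qed
  moreover have "\<bar>y n - f n s\<bar> \<le> K * d x s powr \<alpha>" if "s \<in> S" for n s
  proof -
    have "a n \<le> y n" "y n \<le> b n" using ab[of n] by (auto simp: y_def)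
    with a_ge[OF that, of n] b_le[OF that, of n] show ?thesis by linarith
  qed
  ultimately show ?thesis by (auto simp: convergent_def)
qed

end

section \<open>From one new point to the whole space\<close>

lemma holder_extension_from_one_point:
  fixes X :: "'a metric" and Y :: "'b metric"
  assumes one_point: "\<And>S f x. S \<subseteq> mspace X \<Longrightarrow> holder_map (submetric X S) Y K \<alpha> f \<Longrightarrow>
      x \<in> mspace X \<Longrightarrow> \<exists>y\<in>mspace Y. \<forall>s\<in>S. mdist Y y (f s) \<le> K * mdist X x s powr \<alpha>"
    and S: "S \<subseteq> mspace X" and f: "holder_map (submetric X S) Y K \<alpha> f"
  shows "\<exists>g. holder_map X Y K \<alpha> g \<and> (\<forall>x\<in>S. g x = f x)"
proof -
  interpret X: Metric_space "mspace X" "mdist X" by simp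
  interpret Y: Metric_space "mspace Y" "mdist Y" by simp
  \<comment> \<open>Partial extensions are encoded as graphs, so that chains have their unions as
    upper bounds. Single-valuedness is not demanded: the Hoelder bound at distance \<open>0\<close>
    forces it, see \<open>unique\<close>.\<close>
  define holder where "holder G \<longleftrightarrow> G \<subseteq> mspace X \<times> mspace Y \<and>
      (\<forall>p\<in>G. \<forall>q\<in>G. mdist Y (snd p) (snd q) \<le> K * mdist X (fst p) (fst q) powr \<alpha>)" for G
  define \<A> where "\<A> = {G. (\<lambda>s. (s, f s)) ` S \<subseteq> G \<and> holder G}"
  have holder_le: "mdist Y (snd p) (snd q) \<le> K * mdist X (fst p) (fst q) powr \<alpha>"
    if "holder G" "p \<in> G" "q \<in> G" for G p q
    using that unfolding holder_def by blast
  have unique: "y = z" if "holder G" "(x, y) \<in> G" "(x, z) \<in> G" for G x y z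
  proof -
    have "x \<in> mspace X" and yz: "y \<in> mspace Y" "z \<in> mspace Y"
      using that by (auto simp: holder_def)
    have "mdist Y y z \<le> K * mdist X x x powr \<alpha>"
      using holder_le[OF that] by simp
    with \<open>x \<in> mspace X\<close> have "mdist Y y z \<le> 0" by simp
    then show ?thesis
      using yz Y.nonneg[of y z] by (simp add: order_antisym_conv)
  qed
  have "holder ((\<lambda>s. (s, f s)) ` S)"
    using f S by (auto simp: holder_map_def holder_def)
  then have "\<A> \<noteq> {}" by (auto simp: \<A>_def)
  moreover have "\<Union>\<C> \<in> \<A>" if "\<C> \<noteq> {}" "subset.chain \<A> \<C>" for \<C>
  proof -
    have *: "\<And>G. G \<in> \<C> \<Longrightarrow> (\<lambda>s. (s, f s)) ` S \<subseteq> G \<and> holder G"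
      using that by (auto simp: subset.chain_def \<A>_def)
    have "mdist Y (snd p) (snd q) \<le> K * mdist X (fst p) (fst q) powr \<alpha>"
      if "p \<in> \<Union>\<C>" "q \<in> \<Union>\<C>" for p q
    proof -
      from that obtain G H where "G \<in> \<C>" "H \<in> \<C>" "p \<in> G" "q \<in> H" by auto
      moreover have "G \<subseteq> H \<or> H \<subseteq> G"
        using \<open>subset.chain \<A> \<C>\<close> \<open>G \<in> \<C>\<close> \<open>H \<in> \<C>\<close> by (auto simp: subset_chain_def)
      ultimately obtain G where "G \<in> \<C>" "p \<in> G" "q \<in> G" by blast
      with * show ?thesis by (auto simp: holder_def)
    qed
    then have "holder (\<Union>\<C>)"
      using * unfolding holder_def by blast
    then show ?thesis
      using * \<open>\<C> \<noteq> {}\<close> unfolding \<A>_def by blast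
  qed
  ultimately obtain G where G: "G \<in> \<A>" and max: "\<And>H. H \<in> \<A> \<Longrightarrow> G \<subseteq> H \<Longrightarrow> H = G"
    using subset_Zorn_nonempty[of \<A>] by auto
  have fG: "(\<lambda>s. (s, f s)) ` S \<subseteq> G" and hG: "holder G"
    using G by (auto simp: \<A>_def)
  obtain h where h: "\<And>s. s \<in> fst ` G \<Longrightarrow> (s, h s) \<in> G"
  proof -
    have "\<forall>s\<in>fst ` G. \<exists>y. (s, y) \<in> G" by auto
    then show thesis using that by (metis (no_types))
  qed
  have h_in: "h s \<in> mspace Y" if "s \<in> fst ` G" for s
    using h[OF that] hG by (auto simp: holder_def)
  have h_le: "mdist Y (h s) (h t) \<le> K * mdist X s t powr \<alpha>"
    if "s \<in> fst ` G" "t \<in> fst ` G" for s t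
    using holder_le[OF hG h[OF that(1)] h[OF that(2)]] by simp
  have hX: "fst ` G \<subseteq> mspace X"
    using hG by (auto simp: holder_def)
  have total: "x \<in> fst ` G" if x: "x \<in> mspace X" for x
  proof -
    have "holder_map (submetric X (fst ` G)) Y K \<alpha> h"
      unfolding holder_map_def using h_in h_le by simp
    then obtain y where y: "y \<in> mspace Y"
      and bound: "\<forall>s\<in>fst ` G. mdist Y y (h s) \<le> K * mdist X x s powr \<alpha>"
      using one_point[OF hX _ x] by blast
    have bound': "mdist Y y (snd p) \<le> K * mdist X x (fst p) powr \<alpha>" if "p \<in> G" for p
    proof -
      have "fst p \<in> fst ` G" using that by (rule imageI)
      moreover from this have "h (fst p) = snd p"
        using unique[OF hG h] that by simp
      ultimately show ?thesis using bound by metis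
    qed
    have "holder (insert (x, y) G)"
      unfolding holder_def
    proof (intro conjI ballI)
      show "insert (x, y) G \<subseteq> mspace X \<times> mspace Y"
        using hG x y by (auto simp: holder_def)
      have bound'': "mdist Y (snd p) y \<le> K * mdist X (fst p) x powr \<alpha>" if "p \<in> G" for p
        using bound'[OF that] by (simp only: X.commute[of "fst p" x] Y.commute[of "snd p" y])
      show "mdist Y (snd p) (snd q) \<le> K * mdist X (fst p) (fst q) powr \<alpha>"
        if "p \<in> insert (x, y) G" "q \<in> insert (x, y) G" for p q
        using that bound' bound'' holder_le[OF hG] x y by auto
    qed
    then have "insert (x, y) G = G"
      using fG by (intro max) (auto simp: \<A>_def)
    then have "(x, y) \<in> G" by blast
    then show ?thesis by force
  qed
  have "holder_map X Y K \<alpha> h"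
    using h_in h_le total by (auto simp: holder_map_def)
  moreover have "h s = f s" if "s \<in> S" for s
  proof (rule unique[OF hG])
    show "(s, h s) \<in> G" using h total S that by blast
    show "(s, f s) \<in> G" using fG that by blast
  qed
  ultimately show ?thesis by blast
qed

section \<open>Transfer to the sequence space \<open>c\<close>\<close>

lemma mspace_c: "mspace c_metric = {y. convergent (apply_bcontfun y)}"
  by (simp add: c_metric_def)

lemma mdist_c_le_iff: "mdist c_metric x y \<le> r \<longleftrightarrow> (\<forall>n. \<bar>apply_bcontfun x n - apply_bcontfun y n\<bar> \<le> r)"
proof -
  have "mdist c_metric x y = dist x y" by (simp add: c_metric_def)
  then show ?thesis
    using dist_bounded[of x _ y] dist_bound[of x y r]
    by (auto simp: dist_real_def intro: order_trans)
qed

lemma holder_map_c_iff: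
  "holder_map X c_metric K \<alpha> f \<longleftrightarrow>
    (\<forall>x\<in>mspace X. convergent (apply_bcontfun (f x))) \<and>
    (\<forall>x\<in>mspace X. \<forall>y\<in>mspace X. \<forall>n.
      \<bar>apply_bcontfun (f x) n - apply_bcontfun (f y) n\<bar> \<le> K * mdist X x y powr \<alpha>)"
  by (auto simp: holder_map_def mdist_c_le_iff mspace_c)

lemma apply_Bcontfun_convergent:
  "apply_bcontfun (Bcontfun y) = y" if "convergent y" for y :: "nat \<Rightarrow> real"
  using apply_bcontfun_mspace_c that by (metis apply_bcontfun_inverse image_iff mem_Collect_eq)

text \<open>A bound on the supremum distance is the same bound in every coordinate, so a new value
  in \<open>c\<close> is exactly a convergent sequence of admissible coordinates.\<close>

lemma proper_holder_ext_exponents_c: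
  fixes X :: "'a metric"
  assumes \<alpha>: "0 < \<alpha>" "\<alpha> < 1"
    and proper: "\<And>B. Metric_space.mbounded (mspace X) (mdist X) B \<Longrightarrow>
      Metric_space.mtotally_bounded (mspace X) (mdist X) B"
  shows "\<alpha> \<in> holder_ext_exponents X c_metric"
proof -
  interpret Metric_space "mspace X" "mdist X" by simp
  have "\<exists>y\<in>mspace c_metric. \<forall>s\<in>S. mdist c_metric y (f s) \<le> K * mdist X x s powr \<alpha>"
    if K: "K > 0" and S: "S \<subseteq> mspace X" and f: "holder_map (submetric X S) c_metric K \<alpha> f"
      and x: "x \<in> mspace X" for K S f x
  proof -
    have "\<exists>y. convergent y \<and>
        (\<forall>n. \<forall>s\<in>S. \<bar>y n - apply_bcontfun (f s) n\<bar> \<le> K * mdist X x s powr \<alpha>)"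
      by (rule holder_convergent_one_point_extension[OF \<alpha> K proper S x])
        (use f S in \<open>auto simp: holder_map_c_iff Int_absorb2\<close>)
    then obtain y where y: "convergent y"
      and le: "\<And>n s. s \<in> S \<Longrightarrow> \<bar>y n - apply_bcontfun (f s) n\<bar> \<le> K * mdist X x s powr \<alpha>"
      by blast
    then show ?thesis
      by (intro bexI[of _ "Bcontfun y"])
        (simp_all add: mdist_c_le_iff apply_Bcontfun_convergent mspace_c)
  qed
  then show ?thesis
    using \<alpha> unfolding holder_ext_exponents_def
    by (auto intro!: holder_extension_from_one_point)
qed

section \<open>Total boundedness of bounded sets in the sum norm\<close>

lemma norm_vec_4: "norm (x :: real ^ 4) = sqrt ((x $ 1)\<^sup>2 + (x $ 2)\<^sup>2 + (x $ 3)\<^sup>2 + (x $ 4)\<^sup>2)"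
  by (simp add: norm_vec_def L2_set_def sum_4)

lemma norm_le_l2_sum1_norm: "norm x \<le> l2_sum1_norm x"
  using sqrt_add_le_add_sqrt[of "(x $ 1)\<^sup>2 + (x $ 2)\<^sup>2" "(x $ 3)\<^sup>2 + (x $ 4)\<^sup>2"]
  by (simp add: norm_vec_4 l2_sum1_norm_def add.assoc)

lemma l2_sum1_norm_le_norm: "l2_sum1_norm x \<le> 2 * norm x"
proof -
  have "sqrt ((x $ 1)\<^sup>2 + (x $ 2)\<^sup>2) \<le> norm x" "sqrt ((x $ 3)\<^sup>2 + (x $ 4)\<^sup>2) \<le> norm x"
    by (auto simp: norm_vec_4 intro: real_sqrt_le_mono)
  then show ?thesis by (simp add: l2_sum1_norm_def)
qed

text \<open>The sum norm lies between \<open>norm\<close> and \<open>2 * norm\<close>, so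
  compactness of closed bounded Euclidean sets carries over; the factor 2 explains the radius
  \<open>e / 2\<close>.\<close>

lemma mtotally_bounded_l2_sum1:
  assumes "Metric_space.mbounded UNIV (\<lambda>x y. l2_sum1_norm (x - y)) B"
  shows "Metric_space.mtotally_bounded UNIV (\<lambda>x y. l2_sum1_norm (x - y)) B"
proof -
  interpret Metric_space UNIV "\<lambda>x y. l2_sum1_norm (x - y)"
    by (rule Metric_space_l2_sum1)
  obtain x r where r: "\<And>y. y \<in> B \<Longrightarrow> l2_sum1_norm (x - y) \<le> r"
    using assms by (auto simp: mbounded_def subset_eq)
  have "norm (x - y) \<le> r" if "y \<in> B" for y
    using norm_le_l2_sum1_norm[of "x - y"] r[OF that] by linarith
  then have "bounded B"
    by (auto simp: bounded_def dist_norm)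
  then have "compact (closure B)" by simp
  show ?thesis
    unfolding mtotally_bounded_def
  proof (intro allI impI)
    fix e :: real assume "e > 0"
    have "closure B \<subseteq> (\<Union>s\<in>B. ball s (e / 2))"
    proof
      fix z assume "z \<in> closure B"
      then obtain s where "s \<in> B" "dist s z < e / 2"
        using \<open>e > 0\<close> unfolding closure_approachable by (meson half_gt_zero)
      then show "z \<in> (\<Union>s\<in>B. ball s (e / 2))" by (intro UN_I) auto
    qed
    then obtain T where T: "T \<subseteq> B" "finite T" "closure B \<subseteq> (\<Union>s\<in>T. ball s (e / 2))"
      using compactE_image[OF \<open>compact (closure B)\<close>, of B "\<lambda>s. ball s (e / 2)"] by auto
    have ball: "ball s (e / 2) \<subseteq> mball s e" for s
    proof
      fix y assume "y \<in> ball s (e / 2)"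
      then show "y \<in> mball s e"
        using l2_sum1_norm_le_norm[of "s - y"] by (simp add: dist_norm)
    qed
    have "B \<subseteq> (\<Union>s\<in>T. ball s (e / 2))"
      using closure_subset T(3) by (rule order_trans)
    also have "\<dots> \<subseteq> (\<Union>s\<in>T. mball s e)"
      using ball by (intro UN_mono order_refl)
    finally show "\<exists>T. finite T \<and> T \<subseteq> B \<and> B \<subseteq> (\<Union>s\<in>T. mball s e)"
      using T(1,2) by blast
  qed
qed

section \<open>Failure for exponent one\<close>

text \<open>
  A point \<open>q\<close> of this parabola has norm \<open>n\<^sup>2 + 1\<close>, so \<open>\<parallel>q\<parallel>\<close> exceeds its first coordinate, the
  Busemann function of the axis, by exactly \<open>2\<close>: the gap between the constants \<open>1\<close> and \<open>- 1\<close>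
  in \<open>busemann_seq\<close>.
\<close>

definition par_left :: "nat \<Rightarrow> real ^ 4" where
  "par_left n = vector [(real n)\<^sup>2 - 1, 2 * real n, 0, 0]"

definition par_right :: "nat \<Rightarrow> real ^ 4" where
  "par_right n = vector [0, 0, (real n)\<^sup>2 - 1, 2 * real n]"

lemma par_nth [simp]:
  "par_left n $ 1 = (real n)\<^sup>2 - 1" "par_left n $ 2 = 2 * real n" "par_left n $ 3 = 0" "par_left n $ 4 = 0"
  "par_right n $ 1 = 0" "par_right n $ 2 = 0" "par_right n $ 3 = (real n)\<^sup>2 - 1" "par_right n $ 4 = 2 * real n"
  by (simp_all add: par_left_def par_right_def vector_def)

definition busemann_seq :: "real ^ 4 \<Rightarrow> nat \<Rightarrow> real" where
  "busemann_seq z n =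
     (if even n then 1 + l2_sum1_norm (par_right n) - l2_sum1_norm (par_right n - z)
      else - 1 - l2_sum1_norm (par_left n) + l2_sum1_norm (par_left n - z))"

section \<open>Lipschitz bound and limits on the parabolas\<close>

lemma busemann_seq_lipschitz: "\<bar>busemann_seq z n - busemann_seq w n\<bar> \<le> l2_sum1_norm (z - w)"
proof -
  have "\<bar>l2_sum1_norm (p - z) - l2_sum1_norm (p - w)\<bar> \<le> l2_sum1_norm (z - w)" for p
    using l2_sum1_norm_triangle[of "p - z" "z - w"] l2_sum1_norm_triangle[of "p - w" "w - z"]
    by (simp add: l2_sum1_norm_minus_commute[of w z])
  from this[of "par_right n"] this[of "par_left n"] show ?thesis
    by (auto simp: busemann_seq_def abs_le_iff)
qed

text \<open>As a complex number the parabola point is the square of \<open>t + i\<close>, of modulus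
  \<open>t^2 + 1\<close>.\<close>

lemma sqrt_par: "sqrt ((t\<^sup>2 - 1)\<^sup>2 + 4 * t\<^sup>2) = t\<^sup>2 + 1" for t :: real
  by (rule real_sqrt_unique) (auto simp: power2_eq_square algebra_simps)

lemma tendsto_par_defect:
  "(\<lambda>n. (real n)\<^sup>2 + 1 - sqrt (((real n)\<^sup>2 - j\<^sup>2)\<^sup>2 + (2 * real n - 2 * j)\<^sup>2)) \<longlonglongrightarrow> j\<^sup>2 - 1"
proof -
  \<comment> \<open>The radicand is \<open>n^4 + (4 - 2 * j^2) * n^2\<close> up to order
    \<open>n\<close>, so its root is \<open>n^2 + (4 - 2 * j^2) / 2\<close> up to a null
    sequence.\<close>
  have "(\<lambda>n. (real n)\<^sup>2 + 1 - sqrt (((real n)\<^sup>2 - j\<^sup>2)\<^sup>2 + (2 * real n - 2 * j)\<^sup>2))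
      \<longlonglongrightarrow> 1 - (4 - j\<^sup>2 * 2) / 2"
    by real_asymp
  also have "1 - (4 - j\<^sup>2 * 2) / 2 = j\<^sup>2 - 1" by (simp add: field_simps)
  finally show ?thesis .
qed

lemma convergent_alternating:
  fixes a b :: "nat \<Rightarrow> 'a::topological_space"
  assumes "a \<longlonglongrightarrow> l" "b \<longlonglongrightarrow> l"
  shows "convergent (\<lambda>n. if even n then a n else b n)"
proof -
  have "(\<lambda>n. if even n then a n else b n) \<longlonglongrightarrow> l"
    using assms by (auto intro!: filterlim_If simp: tendsto_mono[OF inf_le1])
  then show ?thesis by (auto simp: convergent_def)
qed

text \<open>For odd \<open>n\<close> the two points lie in different planes, where the sum norm is
  additive: the norm of \<open>par_left n\<close> cancels and leaves the constant
  \<open>- 1 + (j^2 + 1)\<close>. The even terms tend to the same \<open>j^2\<close>.\<close>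

lemma convergent_busemann_seq_right: "convergent (busemann_seq (par_right j))"
proof -
  have "(\<lambda>n. 1 + ((real n)\<^sup>2 + 1 - sqrt (((real n)\<^sup>2 - (real j)\<^sup>2)\<^sup>2 + (2 * real n - 2 * real j)\<^sup>2)))
      \<longlonglongrightarrow> 1 + ((real j)\<^sup>2 - 1)"
    by (intro tendsto_intros tendsto_par_defect)
  then have "convergent (\<lambda>n. if even n
      then 1 + ((real n)\<^sup>2 + 1 - sqrt (((real n)\<^sup>2 - (real j)\<^sup>2)\<^sup>2 + (2 * real n - 2 * real j)\<^sup>2))
      else (real j)\<^sup>2)"
    by (intro convergent_alternating[of _ "(real j)\<^sup>2"]) auto
  also have "(\<lambda>n. if even n
      then 1 + ((real n)\<^sup>2 + 1 - sqrt (((real n)\<^sup>2 - (real j)\<^sup>2)\<^sup>2 + (2 * real n - 2 * real j)\<^sup>2))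
      else (real j)\<^sup>2) = busemann_seq (par_right j)"
    by (auto simp: busemann_seq_def l2_sum1_norm_def sqrt_par power2_commute[of 1] fun_eq_iff)
  finally show ?thesis .
qed

text \<open>Mirror case: the even terms are constantly \<open>1 - (j^2 + 1)\<close>, and the odd
  ones tend to \<open>- 1 - (j^2 - 1)\<close>.\<close>

lemma convergent_busemann_seq_left: "convergent (busemann_seq (par_left j))"
proof -
  have "(\<lambda>n. - 1 - ((real n)\<^sup>2 + 1 - sqrt (((real n)\<^sup>2 - (real j)\<^sup>2)\<^sup>2 + (2 * real n - 2 * real j)\<^sup>2)))
      \<longlonglongrightarrow> - 1 - ((real j)\<^sup>2 - 1)"
    by (intro tendsto_intros tendsto_par_defect)
  then have "convergent (\<lambda>n. if even n then - (real j)\<^sup>2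
      else - 1 - ((real n)\<^sup>2 + 1 - sqrt (((real n)\<^sup>2 - (real j)\<^sup>2)\<^sup>2 + (2 * real n - 2 * real j)\<^sup>2)))"
    by (intro convergent_alternating[of _ "- (real j)\<^sup>2"]) auto
  also have "(\<lambda>n. if even n then - (real j)\<^sup>2
      else - 1 - ((real n)\<^sup>2 + 1 - sqrt (((real n)\<^sup>2 - (real j)\<^sup>2)\<^sup>2 + (2 * real n - 2 * real j)\<^sup>2)))
      = busemann_seq (par_left j)"
    by (auto simp: busemann_seq_def l2_sum1_norm_def sqrt_par power2_commute[of 1] fun_eq_iff)
  finally show ?thesis .
qed

section \<open>Obstruction at the origin\<close>

lemma one_notin_holder_ext_exponents_l2_sum1_c:
  "1 \<notin> holder_ext_exponents l2_sum1_metric c_metric"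
proof
  assume ext: "1 \<in> holder_ext_exponents l2_sum1_metric c_metric"
  \<comment> \<open>The largest set on which \<open>busemann_seq\<close> takes values in
    \<open>c\<close>. It contains both parabolas but not the origin, where the sequence alternates
    between \<open>1\<close> and \<open>- 1\<close>.\<close>
  define S where "S = {z. convergent (busemann_seq z)}"
  have N0: "0 \<le> l2_sum1_norm z" for z
    by (simp add: l2_sum1_norm_def)
  have ext': "\<exists>g. holder_map l2_sum1_metric c_metric 1 1 g \<and> (\<forall>x\<in>A. g x = f x)"
    if "holder_map (submetric l2_sum1_metric A) c_metric 1 1 f" for A f
    using ext that zero_less_one unfolding holder_ext_exponents_def mspace_l2_sum1 by blast
  have "holder_map (submetric l2_sum1_metric S) c_metric 1 1 (\<lambda>z. Bcontfun (busemann_seq z))"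
    using busemann_seq_lipschitz N0
    by (auto simp: holder_map_c_iff S_def apply_Bcontfun_convergent mdist_l2_sum1)
  from ext'[OF this] obtain g where g: "holder_map l2_sum1_metric c_metric 1 1 g"
    and g_eq: "\<And>z. z \<in> S \<Longrightarrow> g z = Bcontfun (busemann_seq z)"
    by blast
  define y where "y = apply_bcontfun (g 0)"
  have near: "\<bar>y n - busemann_seq z n\<bar> \<le> l2_sum1_norm z" if "z \<in> S" for z n
  proof -
    have "\<bar>y n - apply_bcontfun (g z) n\<bar> \<le> 1 * l2_sum1_norm (0 - z) powr 1"
      using g unfolding holder_map_c_iff mspace_l2_sum1 mdist_l2_sum1 y_def by blast
    then have "\<bar>y n - apply_bcontfun (g z) n\<bar> \<le> l2_sum1_norm (0 - z)"
      using N0 by simp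
    then show ?thesis
      unfolding l2_sum1_norm_minus_commute[of 0 z] using that by (simp add: g_eq S_def apply_Bcontfun_convergent)
  qed
  have norm_0: "l2_sum1_norm 0 = 0" by (simp add: l2_sum1_norm_eq_0)
  \<comment> \<open>At index \<open>2 * n\<close> the sequence of \<open>par_right (2 * n)\<close>
    equals \<open>1\<close> plus the norm of that point, which is also its distance to the
    origin.\<close>
  have even: "1 \<le> y (2 * n)" for n
    using near[of "par_right (2 * n)" "2 * n"] convergent_busemann_seq_right[of "2 * n"]
    by (auto simp: S_def busemann_seq_def norm_0 abs_le_iff)
  have odd: "y (2 * n + 1) \<le> - 1" for n
    using near[of "par_left (2 * n + 1)" "2 * n + 1"] convergent_busemann_seq_left[of "2 * n + 1"]
    by (auto simp: S_def busemann_seq_def norm_0 abs_le_iff)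
  have "convergent y"
    using g by (simp add: holder_map_c_iff mspace_l2_sum1 y_def)
  then obtain l where l: "y \<longlonglongrightarrow> l" by (auto simp: convergent_def)
  have "(\<lambda>n. y (2 * n)) \<longlonglongrightarrow> l" "(\<lambda>n. y (2 * n + 1)) \<longlonglongrightarrow> l"
    using LIMSEQ_subseq_LIMSEQ[OF l, of "\<lambda>n. 2 * n"] LIMSEQ_subseq_LIMSEQ[OF l, of "\<lambda>n. 2 * n + 1"]
    by (auto simp: strict_mono_def o_def)
  then have "1 \<le> l" "l \<le> - 1"
    using even odd by (auto intro: LIMSEQ_le_const LIMSEQ_le_const2)
  then show False by simp
qed

theorem theorem3p9: "holder_ext_exponents l2_sum1_metric c_metric = {0<..<1}"
proof (intro equalityI subsetI)
  fix \<alpha> assume "\<alpha> \<in> holder_ext_exponents l2_sum1_metric c_metric"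
  moreover from this have "\<alpha> \<noteq> 1"
    using one_notin_holder_ext_exponents_l2_sum1_c by blast
  ultimately show "\<alpha> \<in> {0<..<1}"
    by (auto simp: holder_ext_exponents_def)
next
  fix \<alpha> :: real assume "\<alpha> \<in> {0<..<1}"
  moreover have "mdist l2_sum1_metric = (\<lambda>x y. l2_sum1_norm (x - y))"
    by (simp add: mdist_l2_sum1 fun_eq_iff)
  ultimately show "\<alpha> \<in> holder_ext_exponents l2_sum1_metric c_metric"
    using mtotally_bounded_l2_sum1
    by (intro proper_holder_ext_exponents_c) (auto simp: mspace_l2_sum1)
qed

end
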